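(* Every finite semimetric space $(X,d)$ is a $\gamma$-polygon space with $$\gamma = \sup\left\{ \frac{d(x_1,x_n)}{\sum_{k=1}^{n-1} d(x_k,x_{k+1})} \ :\ n\in \mathbb{N},\ x_1,\dots ,x_n\in X,\ x_1\neq x_n \right\}.$$ In particular, every finite semimetric space $(X,d)$ is a $\beta$-metric space with $$\beta = \sup\left\{ \frac{d(x,z)}{d(x,y) + d(y,z)} \ :\ x,y,z\in X,\ x\neq z \right\}.$$
   Context: For a nonempty set $X$, a semimetric on $X$ is a function $d:X\times X\to[0,+\infty)$ such that for all $x,y\in X$: $d(x,y)=0$ if and only if $x=y$, and $d(x,y)=d(y,x)$. The pair $(X,d)$ is called a semimetric space; it is finite if $X$ is finite. A semimetric space $(X,d)$ is a $\beta$-metric space if $\beta\geqslant 1$ is the smallest number such that $d(x,z)\leqslant \beta\,(d(x,y)+d(y,z))$ for all $x,y,z\in X$. A semimetric space $(X,d)$ is a $\gamma$-polygon space if $\gamma\geqslant 1$ is the smallest number such that $d(x_1,x_n)\leqslant \gamma\sum_{k=1}^{n-1}d(x_k,x_{k+1})$ for all $n\in\mathbb{N}$ and all $x_1,\dots,x_n\in X$. *)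

theory Defs
  imports Complex_Main
begin

text \<open>The distance is a total function on the ambient type, but only its values on the
  carrier are constrained; outside it \<open>d\<close> is arbitrary.\<close>

locale semimetric_space =
  fixes X :: "'a set" and d :: "'a \<Rightarrow> 'a \<Rightarrow> real"
  assumes nonempty: "X \<noteq> {}"
    and nonneg: "\<lbrakk>x \<in> X; y \<in> X\<rbrakk> \<Longrightarrow> 0 \<le> d x y"
    and zero_iff: "\<lbrakk>x \<in> X; y \<in> X\<rbrakk> \<Longrightarrow> d x y = 0 \<longleftrightarrow> x = y"
    and commute: "\<lbrakk>x \<in> X; y \<in> X\<rbrakk> \<Longrightarrow> d x y = d y x"

definition relaxed_triangle_ineq :: "'a set \<Rightarrow> ('a \<Rightarrow> 'a \<Rightarrow> real) \<Rightarrow> real \<Rightarrow> bool" where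
  "relaxed_triangle_ineq X d \<beta> \<longleftrightarrow>
     (\<forall>x\<in>X. \<forall>y\<in>X. \<forall>z\<in>X. d x z \<le> \<beta> * (d x y + d y z))"

text \<open>A finite sequence of \<open>n \<ge> 1\<close> points is the restriction of \<open>x :: nat \<Rightarrow> 'a\<close> to \<open>{1..n}\<close>;
  for \<open>n = 1\<close> the sum is empty.\<close>

definition relaxed_polygon_ineq :: "'a set \<Rightarrow> ('a \<Rightarrow> 'a \<Rightarrow> real) \<Rightarrow> real \<Rightarrow> bool" where
  "relaxed_polygon_ineq X d \<gamma> \<longleftrightarrow>
     (\<forall>n\<ge>1. \<forall>x :: nat \<Rightarrow> 'a. (\<forall>k\<in>{1..n}. x k \<in> X) \<longrightarrow>
        d (x 1) (x n) \<le> \<gamma> * (\<Sum>k=1..<n. d (x k) (x (k + 1))))"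

definition beta_metric_space :: "'a set \<Rightarrow> ('a \<Rightarrow> 'a \<Rightarrow> real) \<Rightarrow> real \<Rightarrow> bool" where
  "beta_metric_space X d \<beta> \<longleftrightarrow>
     semimetric_space X d \<and> 1 \<le> \<beta> \<and> relaxed_triangle_ineq X d \<beta> \<and>
     (\<forall>\<beta>'\<ge>1. relaxed_triangle_ineq X d \<beta>' \<longrightarrow> \<beta> \<le> \<beta>')"

definition gamma_polygon_space :: "'a set \<Rightarrow> ('a \<Rightarrow> 'a \<Rightarrow> real) \<Rightarrow> real \<Rightarrow> bool" where
  "gamma_polygon_space X d \<gamma> \<longleftrightarrow>
     semimetric_space X d \<and> 1 \<le> \<gamma> \<and> relaxed_polygon_ineq X d \<gamma> \<and>
     (\<forall>\<gamma>'\<ge>1. relaxed_polygon_ineq X d \<gamma>' \<longrightarrow> \<gamma> \<le> \<gamma>')"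

text \<open>Constants range over \<open>[1, \<infinity>)\<close>, so the empty set has supremum \<open>1\<close>. This case arises
  only for a one-point space; on nonempty sets this is the ordinary real supremum.\<close>

definition sup_const :: "real set \<Rightarrow> real" where
  "sup_const S = (if S = {} then 1 else Sup S)"

end

theory Submission
  imports Defs
begin

text \<open>Finiteness bounds all quotients of distances by a single constant; since a chain with distinct
  endpoints has a nontrivial step, this bounds the quotients in question. They include the value
  \<open>1\<close> (a chain with only one nontrivial step), so their supremum is admissible as a constant.\<close>

text \<open>Common core of the polygon and the triangle case: \<open>I\<close> stands for the chains
  or triples with distinct endpoints, \<open>f\<close> for the distance between the endpoints and
  \<open>g\<close> for the length of the path. \<open>M\<close> bounds the quotients above, so that
  \<open>Sup\<close> is a genuine least upper bound; an index with quotient 1 places it in the range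
  of admissible constants.\<close>

lemma sup_const_least_bound:
  fixes f g :: "'i \<Rightarrow> real" and I :: "'i set"
  defines "c \<equiv> sup_const ((\<lambda>i. f i / g i) ` I)"
  assumes pos: "\<And>i. i \<in> I \<Longrightarrow> 0 < g i"
    and bound: "\<And>i. i \<in> I \<Longrightarrow> f i \<le> M * g i"
    and one: "I \<noteq> {} \<Longrightarrow> \<exists>i\<in>I. f i = g i"
  shows "1 \<le> c" and "\<And>i. i \<in> I \<Longrightarrow> f i \<le> c * g i"
    and "\<And>c'. 1 \<le> c' \<Longrightarrow> (\<And>i. i \<in> I \<Longrightarrow> f i \<le> c' * g i) \<Longrightarrow> c \<le> c'"
proof -
  let ?S = "(\<lambda>i. f i / g i) ` I"
  have bdd: "bdd_above ?S"
    using pos bound by (intro bdd_aboveI2[where M = M]) (simp add: divide_le_eq)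
  have upper: "f i / g i \<le> c" if "i \<in> I" for i
    using that cSup_upper[OF _ bdd] by (auto simp: c_def sup_const_def)
  show "1 \<le> c"
  proof (cases "I = {}")
    case False
    with one obtain i where "i \<in> I" "f i = g i" by blast
    with upper pos show ?thesis by fastforce
  qed (simp add: c_def sup_const_def)
  show "f i \<le> c * g i" if "i \<in> I" for i
    using upper[OF that] pos[OF that] by (simp add: divide_le_eq)
  \<comment> \<open>For empty \<open>I\<close> the default value of \<open>sup_const\<close> makes
    this the hypothesis \<open>1 \<le> c'\<close>; otherwise \<open>c'\<close> is an upper bound of
    the quotients.\<close>
  show "c \<le> c'" if "1 \<le> c'" "\<And>i. i \<in> I \<Longrightarrow> f i \<le> c' * g i" for c'
    using that pos by (auto simp: c_def sup_const_def divide_le_eq intro!: cSup_least)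
qed

context semimetric_space
begin

lemma dist_self [simp]: "x \<in> X \<Longrightarrow> d x x = 0"
  by (simp add: zero_iff)

lemma dist_pos: "\<lbrakk>x \<in> X; y \<in> X; x \<noteq> y\<rbrakk> \<Longrightarrow> 0 < d x y"
  using nonneg zero_iff by (metis less_eq_real_def)

text \<open>Only finitely many quadruples exist, so the quotients have a maximum. Those with
  \<open>u = v\<close> may stay in the set, as division by zero yields 0.\<close>

lemma bounded_distance_ratios:
  assumes "finite X"
  obtains M where "0 \<le> M"
    and "\<And>x z u v. \<lbrakk>x \<in> X; z \<in> X; u \<in> X; v \<in> X; u \<noteq> v\<rbrakk> \<Longrightarrow> d x z \<le> M * d u v"
proof
  let ?R = "(\<lambda>(x, z, u, v). d x z / d u v) ` (X \<times> X \<times> X \<times> X)"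
  let ?M = "Max ?R"
  have ratio: "d x z / d u v \<le> ?M" if "x \<in> X" "z \<in> X" "u \<in> X" "v \<in> X" for x z u v
    using that assms by (intro Max_ge) (auto intro!: image_eqI[where x = "(x, z, u, v)"])
  \<comment> \<open>One point taken four times gives the quotient 0 / 0 = 0.\<close>
  show "0 \<le> ?M"
    using nonempty ratio by fastforce
  show "d x z \<le> ?M * d u v" if "x \<in> X" "z \<in> X" "u \<in> X" "v \<in> X" "u \<noteq> v" for x z u v
    using ratio[of x z u v] that dist_pos[of u v] by (simp add: divide_le_eq)
qed

text \<open>If no step were nontrivial, the chain would be constant from 1 to \<open>n\<close>. One
  summand is at most the whole sum because the others are nonnegative. This yields both the
  positivity of the denominators and their comparison with the numerators.\<close>

lemma chain_nontrivial_step: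
  fixes x :: "nat \<Rightarrow> 'a"
  assumes "1 \<le> n" "\<forall>k\<in>{1..n}. x k \<in> X" "x 1 \<noteq> x n"
  obtains k where "x k \<in> X" "x (k + 1) \<in> X" "x k \<noteq> x (k + 1)"
    "d (x k) (x (k + 1)) \<le> (\<Sum>k=1..<n. d (x k) (x (k + 1)))"
proof -
  have "\<exists>k\<in>{1..<n}. x k \<noteq> x (k + 1)"
  proof (rule ccontr)
    assume "\<not> ?thesis"
    then have const: "x (k + 1) = x k" if "k \<in> {1..<n}" for k
      using that by force
    have "m \<le> n \<longrightarrow> x m = x 1" if "1 \<le> m" for m
      using that const by (induction m rule: dec_induct) auto
    from this[of n] assms show False by simp
  qed
  then obtain k where k: "k \<in> {1..<n}" "x k \<noteq> x (k + 1)" by blast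
  moreover have "d (x k) (x (k + 1)) \<le> (\<Sum>k=1..<n. d (x k) (x (k + 1)))"
    using k assms by (intro member_le_sum) (auto intro: nonneg)
  moreover have "x k \<in> X" "x (k + 1) \<in> X"
    using k(1) assms(2) by auto
  ultimately show thesis
    by (intro that)
qed

lemma chain_length_nonneg:
  fixes x :: "nat \<Rightarrow> 'a"
  shows "\<forall>k\<in>{1..n}. x k \<in> X \<Longrightarrow> 0 \<le> (\<Sum>k=1..<n. d (x k) (x (k + 1)))"
  by (intro sum_nonneg nonneg) simp_all

lemma gamma_polygon_space_sup:
  assumes "finite X"
  shows "gamma_polygon_space X d
    (sup_const {d (x 1) (x n) / (\<Sum>k=1..<n. d (x k) (x (k + 1))) | (n :: nat) (x :: nat \<Rightarrow> 'a).
       n \<ge> 1 \<and> (\<forall>k\<in>{1..n}. x k \<in> X) \<and> x 1 \<noteq> x n})"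
proof -
  obtain M where M: "0 \<le> M"
    "\<And>x z u v. \<lbrakk>x \<in> X; z \<in> X; u \<in> X; v \<in> X; u \<noteq> v\<rbrakk> \<Longrightarrow> d x z \<le> M * d u v"
    using bounded_distance_ratios[OF assms] by blast
  define I :: "(nat \<times> (nat \<Rightarrow> 'a)) set"
    where "I = {(n, x). n \<ge> 1 \<and> (\<forall>k\<in>{1..n}. x k \<in> X) \<and> x 1 \<noteq> x n}"
  define f where "f = (\<lambda>(n :: nat, x :: nat \<Rightarrow> 'a). d (x 1) (x n))"
  define g where "g = (\<lambda>(n :: nat, x :: nat \<Rightarrow> 'a). \<Sum>k=1..<n. d (x k) (x (k + 1)))"
  define c where "c = sup_const ((\<lambda>i. f i / g i) ` I)"
  have pos: "0 < g i" if i_in: "i \<in> I" for i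
  proof -
    obtain n x where i: "i = (n, x)" "1 \<le> n" "\<forall>k\<in>{1..n}. x k \<in> X" "x 1 \<noteq> x n"
      using i_in by (auto simp: I_def)
    obtain k where k: "x k \<in> X" "x (k + 1) \<in> X" "x k \<noteq> x (k + 1)"
      "d (x k) (x (k + 1)) \<le> g i"
      unfolding g_def i(1) prod.case by (rule chain_nontrivial_step[OF i(2-)])
    then show ?thesis
      using dist_pos by (meson less_le_trans)
  qed
  have bound: "f i \<le> M * g i" if i_in: "i \<in> I" for i
  proof -
    obtain n x where i: "i = (n, x)" "1 \<le> n" "\<forall>k\<in>{1..n}. x k \<in> X" "x 1 \<noteq> x n"
      using i_in by (auto simp: I_def)
    obtain k where k: "x k \<in> X" "x (k + 1) \<in> X" "x k \<noteq> x (k + 1)"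
      "d (x k) (x (k + 1)) \<le> g i"
      unfolding g_def i(1) prod.case by (rule chain_nontrivial_step[OF i(2-)])
    \<comment> \<open>The endpoint distance is compared with one nontrivial step alone;
      \<open>0 \<le> M\<close> then allows passing to the whole length.\<close>
    have "f i \<le> M * d (x k) (x (k + 1))"
      using i k M(2) by (simp add: f_def)
    also have "\<dots> \<le> M * g i"
      using k M(1) by (simp add: mult_left_mono)
    finally show ?thesis .
  qed
  have one: "\<exists>i\<in>I. f i = g i" if I_ne: "I \<noteq> {}"
  proof -
    obtain n x where nx: "(1 :: nat) \<le> n" "\<forall>k\<in>{1..n}. x k \<in> X" "x 1 \<noteq> x n"
      using I_ne by (auto simp: I_def)
    \<comment> \<open>The two-point chain that jumps directly between the given endpoints has
      quotient 1.\<close>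
    define y where "y = (\<lambda>k :: nat. if k = 1 then x 1 else x n)"
    have "(2, y) \<in> I" using nx by (auto simp: I_def y_def)
    moreover have "f (2, y) = g (2, y)"
      by (simp add: f_def g_def y_def numeral_2_eq_2)
    ultimately show ?thesis by blast
  qed
  \<comment> \<open>Chains with equal endpoints lie outside \<open>I\<close> but impose no condition
    on \<open>c'\<close>: the left side is 0 and the right side is nonnegative.\<close>
  have ineq_iff: "relaxed_polygon_ineq X d c' \<longleftrightarrow> (\<forall>i\<in>I. f i \<le> c' * g i)" if "1 \<le> c'" for c'
  proof
    show "relaxed_polygon_ineq X d c' \<Longrightarrow> \<forall>i\<in>I. f i \<le> c' * g i"
      by (auto simp: relaxed_polygon_ineq_def I_def f_def g_def)
    assume le: "\<forall>i\<in>I. f i \<le> c' * g i"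
    have "f (n, x) \<le> c' * g (n, x)" if nx: "1 \<le> n" "\<forall>k\<in>{1..n}. x k \<in> X" for n x
    proof (cases "x 1 = x n")
      case True
      then have "f (n, x) = 0" using nx by (simp add: f_def)
      moreover have "0 \<le> g (n, x)"
        using chain_length_nonneg[OF nx(2)] by (simp add: g_def)
      ultimately show ?thesis using \<open>1 \<le> c'\<close> by simp
    next
      case False
      with nx have "(n, x) \<in> I" by (simp add: I_def)
      with le show ?thesis by blast
    qed
    then show "relaxed_polygon_ineq X d c'"
      by (simp add: relaxed_polygon_ineq_def f_def g_def)
  qed
  note sup = sup_const_least_bound[of I g f M, OF pos bound one, folded c_def]
  have "gamma_polygon_space X d c"
    unfolding gamma_polygon_space_def
    using semimetric_space_axioms sup ineq_iff by blast
  moreover have "(\<lambda>i. f i / g i) ` I =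
      {d (x 1) (x n) / (\<Sum>k=1..<n. d (x k) (x (k + 1))) | (n :: nat) (x :: nat \<Rightarrow> 'a).
         n \<ge> 1 \<and> (\<forall>k\<in>{1..n}. x k \<in> X) \<and> x 1 \<noteq> x n}"
    by (simp add: I_def f_def g_def image_def Bex_def conj_commute)
  ultimately show ?thesis by (simp only: c_def)
qed

text \<open>The scheme of the polygon case, run again for triples: longer chains may force a larger
  constant, so the least \<open>\<beta>\<close> cannot be read off from the least
  \<open>\<gamma>\<close>.\<close>

lemma beta_metric_space_sup:
  assumes "finite X"
  shows "beta_metric_space X d
    (sup_const {d x z / (d x y + d y z) | x y z. x \<in> X \<and> y \<in> X \<and> z \<in> X \<and> x \<noteq> z})"
proof -
  obtain M where M: "0 \<le> M"
    "\<And>x z u v. \<lbrakk>x \<in> X; z \<in> X; u \<in> X; v \<in> X; u \<noteq> v\<rbrakk> \<Longrightarrow> d x z \<le> M * d u v"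
    using bounded_distance_ratios[OF assms] by blast
  define I where "I = {(x, y, z). x \<in> X \<and> y \<in> X \<and> z \<in> X \<and> x \<noteq> z}"
  define f where "f = (\<lambda>(x, y :: 'a, z). d x z)"
  define g where "g = (\<lambda>(x, y, z). d x y + d y z)"
  define c where "c = sup_const ((\<lambda>i. f i / g i) ` I)"
  have pos: "0 < g i" if i_in: "i \<in> I" for i
  proof -
    obtain x y z where i: "i = (x, y, z)" "x \<in> X" "y \<in> X" "z \<in> X" "x \<noteq> z"
      using i_in by (auto simp: I_def)
    \<comment> \<open>Since \<open>x \<noteq> z\<close>, the point \<open>y\<close> differs from at
      least one of them: if \<open>x = y\<close>, the second leg is positive, otherwise the
      first.\<close>
    then show ?thesis
      using dist_pos[of x y] dist_pos[of x z] nonneg[of y z]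
      by (cases "x = y") (auto simp: g_def)
  qed
  have bound: "f i \<le> M * g i" if i_in: "i \<in> I" for i
  proof -
    obtain x y z where i: "i = (x, y, z)" "x \<in> X" "y \<in> X" "z \<in> X" "x \<noteq> z"
      using i_in by (auto simp: I_def)
    then have "0 \<le> M * d x y" "0 \<le> M * d y z"
      using M(1) nonneg by simp_all
    \<comment> \<open>The nontrivial leg alone dominates \<open>d x z\<close>; the other one adds a
      nonnegative term.\<close>
    with i M(2)[of x z x y] M(2)[of x z y z] show ?thesis
      by (cases "x = y") (auto simp: f_def g_def distrib_left)
  qed
  have one: "\<exists>i\<in>I. f i = g i" if I_ne: "I \<noteq> {}"
  proof -
    obtain x z where "x \<in> X" "z \<in> X" "x \<noteq> z"
      using I_ne by (auto simp: I_def)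
    \<comment> \<open>The degenerate triple with \<open>y = x\<close> has quotient 1, as its first
      leg vanishes.\<close>
    then have "(x, x, z) \<in> I" "f (x, x, z) = g (x, x, z)"
      by (simp_all add: I_def f_def g_def)
    then show ?thesis by blast
  qed
  have ineq_iff: "relaxed_triangle_ineq X d c' \<longleftrightarrow> (\<forall>i\<in>I. f i \<le> c' * g i)" if "1 \<le> c'" for c'
  proof
    show "relaxed_triangle_ineq X d c' \<Longrightarrow> \<forall>i\<in>I. f i \<le> c' * g i"
      by (auto simp: relaxed_triangle_ineq_def I_def f_def g_def)
    assume le: "\<forall>i\<in>I. f i \<le> c' * g i"
    have "d x z \<le> c' * (d x y + d y z)" if "x \<in> X" "y \<in> X" "z \<in> X" for x y z
    proof (cases "x = z")
      case True
      with that \<open>1 \<le> c'\<close> nonneg show ?thesis by simp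
    next
      case False
      with that have "(x, y, z) \<in> I" by (simp add: I_def)
      with le show ?thesis by (fastforce simp: f_def g_def)
    qed
    then show "relaxed_triangle_ineq X d c'"
      by (simp add: relaxed_triangle_ineq_def)
  qed
  note sup = sup_const_least_bound[of I g f M, OF pos bound one, folded c_def]
  have "beta_metric_space X d c"
    unfolding beta_metric_space_def
    using semimetric_space_axioms sup ineq_iff by blast
  moreover have "(\<lambda>i. f i / g i) ` I =
      {d x z / (d x y + d y z) | x y z. x \<in> X \<and> y \<in> X \<and> z \<in> X \<and> x \<noteq> z}"
    by (simp add: I_def f_def g_def image_def Bex_def conj_commute)
  ultimately show ?thesis by (simp only: c_def)
qed

end

theorem theorem1:
  fixes X :: "'a set" and d :: "'a \<Rightarrow> 'a \<Rightarrow> real"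
  assumes "semimetric_space X d" and "finite X"
  shows "gamma_polygon_space X d
           (sup_const {d (x 1) (x n) / (\<Sum>k=1..<n. d (x k) (x (k + 1))) | (n :: nat) (x :: nat \<Rightarrow> 'a).
              n \<ge> 1 \<and> (\<forall>k\<in>{1..n}. x k \<in> X) \<and> x 1 \<noteq> x n})
       \<and> beta_metric_space X d
           (sup_const {d x z / (d x y + d y z) | x y z.
              x \<in> X \<and> y \<in> X \<and> z \<in> X \<and> x \<noteq> z})"
  using semimetric_space.gamma_polygon_space_sup[OF assms] semimetric_space.beta_metric_space_sup[OF assms]
  by (rule conjI)

end
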